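(* $\chi(\mathrm{S\text{-}Forb}(C(1,3))\cap\mathcal S)=3$; that is, the maximum chromatic number of a strongly connected digraph containing no subdivision of $C(1,3)$ as a subdigraph is $3$.
   Context: Digraphs are finite, without loops or parallel arcs (two opposite arcs between the same two vertices are allowed). The chromatic number $\chi(D)$ of a digraph $D$ is the chromatic number of its underlying undirected graph. The chromatic number $\chi(\mathcal D)$ of a class $\mathcal D$ of digraphs is the smallest $m$ such that $\chi(D)\le m$ for all $D\in\mathcal D$, or $+\infty$ if no such $m$ exists. $\mathcal S$ is the class of strongly connected digraphs. $C(k,\ell)$ is the oriented cycle with two blocks of lengths $k$ and $\ell$: the union of two internally disjoint directed paths with the same initial vertex and the same terminal vertex (distinct from the initial vertex), one of length $k$ and one of length $\ell$. A subdivision of a digraph $F$ is obtained from $F$ by replacing each arc $uv$ by a directed $(u,v)$-path of length at least $1$, these paths being pairwise internally disjoint with new internal vertices. $\mathrm{S\text{-}Forb}(F)$ is the class of digraphs containing no subdivision of $F$ as a subdigraph. *)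

theory Defs
  imports
    "Graph_Theory.Graph_Theory"
    "HOL-Library.Extended_Nat"
    "HOL-Library.Infinite_Typeclass"
begin

text \<open>
  A finite digraph without loops or parallel arcs is a \<^term>\<open>D :: 'a pair_pre_digraph\<close> with
  \<^prop>\<open>pair_digraph D\<close>: its arcs are ordered pairs of vertices, so opposite arcs are allowed.
  A class of digraphs is a set of digraphs whose vertices are taken from a common type.
\<close>

definition proper_colouring :: "'a pair_pre_digraph \<Rightarrow> nat \<Rightarrow> ('a \<Rightarrow> nat) \<Rightarrow> bool" where
  "proper_colouring G k c \<longleftrightarrow>
     (\<forall>v \<in> pverts G. c v < k) \<and> (\<forall>(u, v) \<in> parcs G. c u \<noteq> c v)"

text \<open>The underlying undirected graph of \<open>D\<close> is represented by \<^term>\<open>mk_symmetric D\<close>.\<close>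

definition chromatic_number :: "'a pair_pre_digraph \<Rightarrow> nat" where
  "chromatic_number D = (LEAST k. \<exists>c. proper_colouring (mk_symmetric D) k c)"

definition class_chromatic_number :: "'a pair_pre_digraph set \<Rightarrow> enat" where
  "class_chromatic_number \<D> =
     (if \<exists>m. \<forall>D \<in> \<D>. chromatic_number D \<le> m
      then enat (LEAST m. \<forall>D \<in> \<D>. chromatic_number D \<le> m)
      else \<infinity>)"

definition strong_digraphs :: "'a pair_pre_digraph set" where
  "strong_digraphs = {D. pair_digraph D \<and> strongly_connected D}"

text \<open>
  The two blocks are the path \<open>0, 1, \<dots>, k\<close> and the path \<open>0, k + l - 1, k + l - 2, \<dots>, k\<close>.
  We need \<open>k, l \<ge> 1\<close> and \<open>k + l \<ge> 3\<close>; for \<open>k = l = 1\<close> the two blocks would be parallel arcs.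
\<close>

definition two_block_cycle :: "nat \<Rightarrow> nat \<Rightarrow> nat pair_pre_digraph" where
  "two_block_cycle k l =
     \<lparr> pverts = {..<k + l},
       parcs = {(i, Suc i) | i. i < k} \<union> {(Suc i mod (k + l), i) | i. k \<le> i \<and> i < k + l} \<rparr>"

text \<open>
  \<open>H\<close> is a subdivision of \<open>F\<close>: \<open>\<phi>\<close> embeds the vertices of \<open>F\<close> into \<open>H\<close>, and \<open>P e\<close> is the directed
  path of \<open>H\<close> (given by its list of arcs) that replaces the arc \<open>e\<close> of \<open>F\<close>.
\<close>

definition is_subdivision :: "'b pair_pre_digraph \<Rightarrow> 'a pair_pre_digraph \<Rightarrow> bool" where
  "is_subdivision F H \<longleftrightarrow>
     (\<exists>(\<phi> :: 'b \<Rightarrow> 'a) (P :: 'b \<times> 'b \<Rightarrow> ('a \<times> 'a) awalk).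
        inj_on \<phi> (pverts F) \<and>
        (\<forall>e \<in> parcs F.
           pre_digraph.apath H (\<phi> (fst e)) (P e) (\<phi> (snd e)) \<and>
           length (P e) \<ge> 1 \<and>
           set (pre_digraph.inner_verts H (P e)) \<inter> \<phi> ` pverts F = {}) \<and>
        (\<forall>e \<in> parcs F. \<forall>e' \<in> parcs F. e \<noteq> e' \<longrightarrow>
           set (pre_digraph.inner_verts H (P e)) \<inter> set (pre_digraph.inner_verts H (P e')) = {}) \<and>
        pverts H = \<phi> ` pverts F \<union> (\<Union>e \<in> parcs F. set (pre_digraph.inner_verts H (P e))) \<and>
        parcs H = (\<Union>e \<in> parcs F. set (P e)))"

definition S_Forb :: "'b pair_pre_digraph \<Rightarrow> 'a pair_pre_digraph set" where
  "S_Forb F = {D. pair_digraph D \<and>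
     \<not> (\<exists>H :: 'a pair_pre_digraph. is_subdivision F H \<and> subgraph H D)}"

end

theory Submission
  imports Defs
begin

text \<open>
  The directed triangle has too few vertices to contain a subdivision of $C(1,3)$ and needs three
  colours, so the point is to colour a strong digraph without such a subdivision with three colours.
  
  The colouring grows along an ear decomposition. A strong vertex set \<open>H\<close> that is already
  coloured and is not everything has an ear: a walk that leaves \<open>H\<close>, runs through new vertices
  \<open>p\<^sub>1, \<dots>, p\<^sub>k\<close> and returns to \<open>H\<close>. Any two distinct vertices of \<open>H\<close> are joined by
  a path inside \<open>H\<close>, which together with a path outside \<open>H\<close> forms two blocks; this
  limits how the new vertices can be attached. Take a shortest ear.
  
  If \<open>k \<ge> 2\<close>, an ear with distinct ends \<open>x\<close> and \<open>y\<close> would have length at least 3 and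
  form a subdivision with a path from \<open>x\<close> to \<open>y\<close> in \<open>H\<close>. So the ear is a directed cycle
  attached at one vertex \<open>x\<close>, and \<open>x\<close> is the only neighbour that new vertices have in
  \<open>H\<close>. By minimality there is no forward chord, and a backward arc \<open>p\<^sub>j p\<^sub>i\<close> runs
  parallel to the way round through \<open>x\<close>, which has length at least 3 unless the arc is
  \<open>p\<^sub>k p\<^sub>1\<close>. What remains is a cycle with at most one further edge, which joins the two
  neighbours of \<open>x\<close>; three colours suffice whatever the colour of \<open>x\<close>
  (\<open>three_colouring_add_long_ear\<close>).
  
  If \<open>k = 1\<close>, the new vertex has at most two neighbours in \<open>H\<close>
  (\<open>new_vertex_neighbours\<close>), so one of the three colours is free for it. This is the heart of the
  matter: two in-neighbours in \<open>H\<close> are joined inside \<open>H\<close> by single arcs only, in both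
  directions, so there cannot be three of them; and two in-neighbours leave no room for an out-neighbour
  different from both. Reversing all arcs gives the same for out-neighbours.
\<close>

section \<open>Directed paths as vertex lists\<close>

definition dipath :: "'a rel \<Rightarrow> 'a list \<Rightarrow> bool" where
  "dipath E xs \<longleftrightarrow> distinct xs \<and> successively (\<lambda>a b. (a, b) \<in> E) xs"

text \<open>
  The two paths are the two blocks of a subdivision of $C(1,3)$: paths are lists of vertices, so two
  inner vertices mean length at least 3. Both lists being distinct forces \<open>u \<noteq> v\<close>, and the
  block \<open>qs\<close> has an inner vertex that \<open>ps\<close> lacks, so the two paths do differ.
\<close>
definition has_C13 :: "'a rel \<Rightarrow> bool" where
  "has_C13 E \<longleftrightarrow> (\<exists>u v ps qs. dipath E (u # ps @ [v]) \<and> dipath E (u # qs @ [v]) \<and>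
     set ps \<inter> set qs = {} \<and> 2 \<le> length qs)"

lemma has_C13I:
  assumes "dipath E (u # ps @ [v])" "dipath E (u # qs @ [v])" "set ps \<inter> set qs = {}" "2 \<le> length qs"
  shows "has_C13 E"
  using assms unfolding has_C13_def by blast

lemma dipath_converse: "dipath (E\<inverse>) (rev xs) \<longleftrightarrow> dipath E xs"
  by (simp add: dipath_def)

text \<open>
  Reversal exchanges the two ends of a two-block cycle. It halves the analysis of a single new vertex,
  whose out-neighbours are in-neighbours in the reversed digraph.
\<close>
lemma has_C13_converse: "has_C13 (E\<inverse>) \<Longrightarrow> has_C13 E"
  unfolding has_C13_def
proof (elim exE conjE)
  fix u v ps qs
  assume a: "dipath (E\<inverse>) (u # ps @ [v])" "dipath (E\<inverse>) (u # qs @ [v])"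
    "set ps \<inter> set qs = {}" "2 \<le> length qs"
  have "dipath E (rev (u # ps @ [v]))" "dipath E (rev (u # qs @ [v]))"
    using a dipath_converse[of "E\<inverse>"] by (metis converse_converse)+
  then show "\<exists>u v ps qs. dipath E (u # ps @ [v]) \<and> dipath E (u # qs @ [v]) \<and>
     set ps \<inter> set qs = {} \<and> 2 \<le> length qs"
    using a by (intro exI[of _ v] exI[of _ u] exI[of _ "rev ps"] exI[of _ "rev qs"]) auto
qed

definition strong_on :: "'a rel \<Rightarrow> 'a set \<Rightarrow> bool" where
  "strong_on E H \<longleftrightarrow> (\<forall>u\<in>H. \<forall>v\<in>H. (u, v) \<in> (E \<inter> H \<times> H)\<^sup>*)"

lemma strong_on_converse:
  assumes "strong_on E H" shows "strong_on (E\<inverse>) H"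
proof -
  have "E\<inverse> \<inter> H \<times> H = (E \<inter> H \<times> H)\<inverse>" by auto
  then show ?thesis using assms unfolding strong_on_def by (metis converse_iff rtrancl_converse)
qed

lemma rtrancl_dipath:
  assumes "(u, v) \<in> (E \<inter> H \<times> H)\<^sup>*" "u \<noteq> v"
  shows "\<exists>ws. dipath E (u # ws @ [v]) \<and> set ws \<subseteq> H"
  using assms
proof (induction rule: converse_rtrancl_induct)
  case base
  then show ?case by simp
next
  case (step u w)
  show ?case
  proof (cases "w = v")
    case True
    then show ?thesis using step by (intro exI[of _ "[]"]) (auto simp: dipath_def)
  next
    case False
    then obtain ws where ws: "dipath E (w # ws @ [v])" "set ws \<subseteq> H" using step by blast
    show ?thesis
    proof (cases "u \<in> set (w # ws)")
      case True
      then obtain as bs where wws: "w # ws = as @ u # bs" by (meson split_list)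
      then have "w # ws @ [v] = as @ u # bs @ [v]" by (metis append_Cons append.assoc)
      with ws(1) have "dipath E (as @ u # bs @ [v])" by metis
      then have "dipath E (u # bs @ [v])" by (simp add: dipath_def successively_append_iff)
      moreover have "set bs \<subseteq> set (w # ws)" unfolding wws by auto
      ultimately show ?thesis using ws step by (intro exI[of _ bs]) auto
    next
      case False
      then show ?thesis using ws step
        by (intro exI[of _ "w # ws"]) (auto simp: dipath_def)
    qed
  qed
qed

text \<open>
  This supplies the second block of every forbidden pair: \<open>ws\<close> stays inside \<open>H\<close>, so it
  is disjoint from any path through new vertices.
\<close>
lemma strong_on_dipath:
  assumes "strong_on E H" "u \<in> H" "v \<in> H" "u \<noteq> v"
  obtains ws where "dipath E (u # ws @ [v])" "set ws \<subseteq> H"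
  using rtrancl_dipath assms unfolding strong_on_def by metis

section \<open>A single new vertex has few neighbours\<close>

text \<open>
  A longer path from \<open>a\<close> to \<open>b\<close> could be continued to \<open>z\<close> and would then be
  parallel to the arc from \<open>a\<close> to \<open>z\<close>.
\<close>
lemma in_neighbours_dipath:
  assumes "\<not> has_C13 E" "z \<notin> H" "a \<in> H" "b \<in> H" "(a, z) \<in> E" "(b, z) \<in> E"
    "dipath E (a # ws @ [b])" "set ws \<subseteq> H"
  shows "ws = []"
proof (rule ccontr)
  assume "ws \<noteq> []"
  then have "length (ws @ [b]) \<ge> 2" by (cases ws) auto
  moreover have "dipath E (a # [] @ [z])" "dipath E (a # (ws @ [b]) @ [z])"
    using assms
    by (auto simp: dipath_def successively_append_iff successively_Cons hd_append split: if_splits)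
  ultimately show False using assms(1) has_C13I[of E a "[]" z "ws @ [b]"] by simp
qed

lemma in_neighbours_arc:
  assumes "\<not> has_C13 E" "strong_on E H" "z \<notin> H" "a \<in> H" "b \<in> H" "a \<noteq> b"
    "(a, z) \<in> E" "(b, z) \<in> E"
  shows "(a, b) \<in> E"
  using strong_on_dipath[OF assms(2,4,5,6)] in_neighbours_dipath[OF assms(1,3,4,5,7,8)]
  by (metis append_Nil dipath_def successively.simps(3))

text \<open>
  Three in-neighbours would be pairwise joined by arcs in both directions, so two of them would also
  be joined by the path through the third.
\<close>
lemma in_neighbours_le_2:
  assumes "\<not> has_C13 E" "strong_on E H" "z \<notin> H" "a \<in> H" "b \<in> H" "c \<in> H"
    "(a, z) \<in> E" "(b, z) \<in> E" "(c, z) \<in> E"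
  shows "a = b \<or> b = c \<or> a = c"
proof (rule ccontr)
  assume n: "\<not> ?thesis"
  then have "dipath E (a # [b] @ [c])"
    using assms in_neighbours_arc[OF assms(1-3)] by (auto simp: dipath_def)
  then show False using in_neighbours_dipath[OF assms(1,3,4,6,7,9), of "[b]"] assms by simp
qed

text \<open>
  Suppose \<open>y\<close> differs from \<open>a\<close> and \<open>b\<close>. By symmetry some path returns from
  \<open>y\<close> to \<open>a\<close> without meeting \<open>b\<close>; so \<open>b\<close> has no arc to \<open>y\<close>, which
  would give an indirect path from \<open>b\<close> to \<open>a\<close>. A path from \<open>a\<close> to \<open>y\<close> in
  \<open>H\<close> then always closes a forbidden pair: with \<open>a, z, y\<close> if it is long, with
  \<open>a, b, z, y\<close> if it is an arc, and, prolonged by the arc from \<open>b\<close> to \<open>a\<close>, with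
  \<open>b, z, y\<close> if it has length 2.
\<close>
lemma two_in_neighbours_out_neighbour:
  assumes nb: "\<not> has_C13 E" and st: "strong_on E H" and z: "z \<notin> H"
    and H: "a \<in> H" "b \<in> H" "y \<in> H"
    and arcs: "(a, z) \<in> E" "(b, z) \<in> E" "(z, y) \<in> E"
    and "a \<noteq> b"
  shows "y = a \<or> y = b"
proof (rule ccontr)
  assume n: "\<not> ?thesis"
  \<comment> \<open>The names \<open>a\<close>, \<open>b\<close> are bound anew: the path from \<open>y\<close> may reach either of them first.\<close>
  have avoid: False if ab: "a \<in> H" "b \<in> H" "(a, z) \<in> E" "(b, z) \<in> E" "a \<noteq> b" "y \<noteq> a" "y \<noteq> b"
    and ws: "dipath E (y # ws @ [a])" "set ws \<subseteq> H" "b \<notin> set ws" for a b ws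
  proof -
    have direct: "(a, b) \<in> E" "(b, a) \<in> E"
      using in_neighbours_arc[OF nb st z] ab by auto
    have b_y: "(b, y) \<notin> E"
    proof
      assume "(b, y) \<in> E"
      then have "dipath E (b # (y # ws) @ [a])" using ws ab by (auto simp: dipath_def)
      then show False
        using in_neighbours_dipath[OF nb z ab(2,1,4,3), of "y # ws"] ws H by auto
    qed
    obtain zs where zs: "dipath E (a # zs @ [y])" "set zs \<subseteq> H"
      using strong_on_dipath[OF st ab(1) H(3)] ab by metis
    have "\<not> 2 \<le> length zs"
    proof
      assume "2 \<le> length zs"
      moreover have "dipath E (a # [z] @ [y])"
        using ab arcs z H by (auto simp: dipath_def)
      ultimately show False using has_C13I[OF _ zs(1), of "[z]"] zs nb z by auto
    qed
    then consider "zs = []" | t where "zs = [t]" by (cases zs) (auto simp: Suc_le_eq)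
    then show False
    proof cases
      case 1
      then have "dipath E (a # [] @ [y])" using zs by simp
      moreover have "dipath E (a # [b, z] @ [y])"
        using ab arcs z H direct by (auto simp: dipath_def)
      ultimately show False using has_C13I[of E a "[]" y "[b, z]"] nb by auto
    next
      case 2
      have "dipath E (b # [z] @ [y])"
        using ab arcs z H by (auto simp: dipath_def)
      moreover have "dipath E (b # [a, t] @ [y])"
        using 2 zs b_y ab direct by (auto simp: dipath_def)
      ultimately show False using has_C13I[of E b "[z]" y "[a, t]"] nb z zs 2 ab by auto
    qed
  qed
  obtain ws where ws: "dipath E (y # ws @ [a])" "set ws \<subseteq> H"
    using strong_on_dipath[OF st H(3,1)] n by metis
  show False
  proof (cases "b \<in> set ws")
    case False
    then show False using avoid[of a b ws] ws assms n by auto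
  next
    case True
    then obtain us vs where "ws = us @ b # vs" by (meson split_list)
    then show False using avoid[of b a us] ws assms n
      by (auto simp: dipath_def successively_append_iff successively_Cons hd_append split: if_splits)
  qed
qed

lemma new_vertex_neighbours:
  assumes nb: "\<not> has_C13 E" and st: "strong_on E H" and z: "z \<notin> H"
    and xy: "x \<in> H" "y \<in> H" "(x, z) \<in> E" "(z, y) \<in> E"
  shows "\<exists>a b. {w \<in> H. (w, z) \<in> E \<or> (z, w) \<in> E} \<subseteq> {a, b}"
proof -
  have nb': "\<not> has_C13 (E\<inverse>)" and st': "strong_on (E\<inverse>) H"
    using nb st has_C13_converse strong_on_converse by auto
  note in2 = in_neighbours_le_2[OF nb st z] two_in_neighbours_out_neighbour[OF nb st z]
  note out2 = in_neighbours_le_2[OF nb' st' z, simplified]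
    two_in_neighbours_out_neighbour[OF nb' st' z, simplified]
  consider a b where "a \<in> H" "b \<in> H" "a \<noteq> b" "(a, z) \<in> E" "(b, z) \<in> E"
    | a b where "a \<in> H" "b \<in> H" "a \<noteq> b" "(z, a) \<in> E" "(z, b) \<in> E"
    | "\<And>w. w \<in> H \<Longrightarrow> (w, z) \<in> E \<Longrightarrow> w = x" "\<And>w. w \<in> H \<Longrightarrow> (z, w) \<in> E \<Longrightarrow> w = y"
    using xy by blast
  then show ?thesis
  proof cases
    case (1 a b)
    have "w \<in> {a, b}" if "w \<in> H" "(w, z) \<in> E \<or> (z, w) \<in> E" for w
      using in2(1)[of a b w] in2(2)[of a b w] 1 that by auto
    then show ?thesis by blast
  next
    case (2 a b)
    have "w \<in> {a, b}" if "w \<in> H" "(w, z) \<in> E \<or> (z, w) \<in> E" for w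
      using out2(1)[of a b w] out2(2)[of a b w] 2 that by auto
    then show ?thesis by blast
  next
    case 3
    then show ?thesis by blast
  qed
qed

section \<open>Shortest ears\<close>

text \<open>
  Repeated vertices are allowed in \<open>ps\<close>, and the ends \<open>x\<close>, \<open>y\<close> may coincide;
  distinctness of \<open>ps\<close> comes for free from minimality.
\<close>
definition ear :: "'a rel \<Rightarrow> 'a set \<Rightarrow> 'a set \<Rightarrow> 'a \<Rightarrow> 'a list \<Rightarrow> 'a \<Rightarrow> bool" where
  "ear E S H x ps y \<longleftrightarrow> x \<in> H \<and> y \<in> H \<and> ps \<noteq> [] \<and> set ps \<subseteq> S - H \<and>
     successively (\<lambda>a b. (a, b) \<in> E) (x # ps @ [y])"

text \<open>
  Some arc leaves \<open>H\<close>; from its head follow a path back to \<open>H\<close> until the first vertex of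
  \<open>H\<close>.
\<close>
lemma ear_exists:
  assumes st: "strong_on E S" and H: "H \<subseteq> S" "H \<noteq> {}" "H \<noteq> S"
  shows "\<exists>x ps y. ear E S H x ps y"
proof -
  obtain h v where hv: "h \<in> H" "v \<in> S - H" using H by blast
  have out: "\<exists>x p. (x, p) \<in> E \<and> x \<in> H \<and> p \<in> S - H"
    if "(h, v) \<in> (E \<inter> S \<times> S)\<^sup>*" "h \<in> H" "v \<notin> H" for h v
    using that by (induction rule: converse_rtrancl_induct) auto
  then obtain x p where xp: "(x, p) \<in> E" "x \<in> H" "p \<in> S - H"
    using hv H st unfolding strong_on_def by blast
  have return: "\<exists>ps y. y \<in> H \<and> set ps \<subseteq> S - H \<and> successively (\<lambda>a b. (a, b) \<in> E) (p # ps @ [y])"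
    if "(p, h) \<in> (E \<inter> S \<times> S)\<^sup>*" "p \<in> S - H" "h \<in> H" for p h
    using that
  proof (induction rule: converse_rtrancl_induct)
    case base
    then show ?case by simp
  next
    case (step p q)
    show ?case
    proof (cases "q \<in> H")
      case True
      then show ?thesis using step by (intro exI[of _ "[]"] exI[of _ q]) auto
    next
      case False
      then obtain ps y where "y \<in> H" "set ps \<subseteq> S - H"
        "successively (\<lambda>a b. (a, b) \<in> E) (q # ps @ [y])" using step by auto
      then show ?thesis using step False by (intro exI[of _ "q # ps"] exI[of _ y]) auto
    qed
  qed
  have "(p, h) \<in> (E \<inter> S \<times> S)\<^sup>*" using st xp hv H unfolding strong_on_def by blast
  from return[OF this] xp hv obtain ps y where
    "y \<in> H" "set ps \<subseteq> S - H" "successively (\<lambda>a b. (a, b) \<in> E) (p # ps @ [y])" by blast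
  then have "ear E S H x (p # ps) y" using xp unfolding ear_def by auto
  then show ?thesis by blast
qed

definition shortest_ear :: "'a rel \<Rightarrow> 'a set \<Rightarrow> 'a set \<Rightarrow> 'a \<Rightarrow> 'a list \<Rightarrow> 'a \<Rightarrow> bool" where
  "shortest_ear E S H x ps y \<longleftrightarrow> ear E S H x ps y \<and>
     (\<forall>x' ps' y'. ear E S H x' ps' y' \<longrightarrow> length ps \<le> length ps')"

lemma shortest_ear_exists:
  assumes "strong_on E S" "H \<subseteq> S" "H \<noteq> {}" "H \<noteq> S"
  obtains x ps y where "shortest_ear E S H x ps y"
proof -
  have "\<exists>t. (\<lambda>(x, ps, y). ear E S H x ps y) t" using ear_exists[OF assms] by auto
  from ex_has_least_nat[of "\<lambda>(x, ps, y). ear E S H x ps y" _ "\<lambda>(x, ps, y). length ps"] this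
  show ?thesis using that unfolding shortest_ear_def by fastforce
qed

context
  fixes E :: "'a rel" and S H x ps y
  assumes se: "shortest_ear E S H x ps y"
begin

lemma shortest_ear_ear: "ear E S H x ps y"
  using se unfolding shortest_ear_def by blast

lemma shortest_earD: "ear E S H x' ps' y' \<Longrightarrow> length ps \<le> length ps'"
  using se unfolding shortest_ear_def by blast

text \<open>
  This and the next three facts hold because a repetition, a forward chord, or an arc between the middle
  of the ear and \<open>H\<close> would give a shorter ear.
\<close>
lemma shortest_ear_distinct: "distinct ps"
proof (rule ccontr)
  assume "\<not> distinct ps"
  then obtain as a bs cs where ps: "ps = as @ [a] @ bs @ [a] @ cs" using not_distinct_decomp by blast
  have "ear E S H x (as @ [a] @ cs) y"
    using shortest_ear_ear unfolding ear_def ps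
    by (auto simp: successively_append_iff successively_Cons hd_append split: if_splits)
  from shortest_earD[OF this] show False unfolding ps by simp
qed

lemma shortest_ear_forward:
  assumes "ps = as @ a # bs @ b # cs" "(a, b) \<in> E"
  shows "bs = []"
proof -
  have "ear E S H x (as @ a # b # cs) y"
    using shortest_ear_ear assms(2) unfolding ear_def assms(1)
    by (auto simp: successively_append_iff successively_Cons hd_append split: if_splits)
  from shortest_earD[OF this] show ?thesis unfolding assms by simp
qed

lemma shortest_ear_enter:
  assumes "h \<in> H" "p \<in> set ps" "(h, p) \<in> E"
  shows "p = hd ps"
proof -
  obtain as bs where ps: "ps = as @ p # bs" using assms(2) by (meson split_list)
  have "ear E S H h (p # bs) y"
    using shortest_ear_ear assms unfolding ear_def ps
    by (auto simp: successively_append_iff successively_Cons)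
  from shortest_earD[OF this] show ?thesis unfolding ps by simp
qed

lemma shortest_ear_leave:
  assumes "h \<in> H" "p \<in> set ps" "(p, h) \<in> E"
  shows "p = last ps"
proof -
  obtain as bs where ps: "ps = as @ p # bs" using assms(2) by (meson split_list)
  have "ear E S H x (as @ [p]) h"
    using shortest_ear_ear assms unfolding ear_def ps
    by (auto simp: successively_append_iff successively_Cons hd_append split: if_splits)
  from shortest_earD[OF this] show ?thesis unfolding ps by simp
qed

text \<open>
  Stated for all ends \<open>h\<close>, \<open>k\<close> that fit the ear, not only for \<open>x\<close> and \<open>y\<close>: this
  also makes \<open>x\<close> the only vertex of \<open>H\<close> with an arc to or from the ear.
\<close>
lemma long_ear_closed:
  assumes nb: "\<not> has_C13 E" and st: "strong_on E H" and len: "2 \<le> length ps"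
    and h: "h \<in> H" "k \<in> H" "(h, hd ps) \<in> E" "(last ps, k) \<in> E"
  shows "h = k"
proof (rule ccontr)
  assume "h \<noteq> k"
  then obtain ws where ws: "dipath E (h # ws @ [k])" "set ws \<subseteq> H"
    using strong_on_dipath[OF st h(1,2)] by metis
  have "dipath E (h # ps @ [k])"
    using shortest_ear_ear shortest_ear_distinct h \<open>h \<noteq> k\<close> unfolding ear_def dipath_def
    by (auto simp: successively_append_iff successively_Cons)
  then show False
    using has_C13I[OF ws(1) _ _ len] nb ws shortest_ear_ear unfolding ear_def by blast
qed

text \<open>
  The arc from \<open>a\<close> back to \<open>b\<close> is parallel to the path that finishes the ear, passes
  through \<open>x\<close> and starts the ear again. That path has length at least 3 unless \<open>b\<close> is
  the first and \<open>a\<close> the last vertex of the ear.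
\<close>
lemma long_ear_backward:
  assumes nb: "\<not> has_C13 E" and "x = y"
    and ps: "ps = as @ b # bs @ a # cs" and "(a, b) \<in> E"
  shows "as = [] \<and> cs = []"
proof (rule ccontr)
  assume "\<not> ?thesis"
  then have "2 \<le> length (cs @ x # as)" by (cases as; cases cs) auto
  moreover have "x \<notin> set ps" using shortest_ear_ear unfolding ear_def by blast
  have "dipath E (a # (cs @ x # as) @ [b])"
    using shortest_ear_ear shortest_ear_distinct \<open>x = y\<close> \<open>x \<notin> set ps\<close> unfolding ear_def dipath_def ps
    by (auto simp: successively_append_iff successively_Cons hd_append split: if_splits)
  moreover have "dipath E (a # [] @ [b])"
    using shortest_ear_distinct assms(4) unfolding dipath_def ps by auto
  ultimately show False using has_C13I[of E a "[]" b "cs @ x # as"] nb by simp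
qed

lemma strong_on_add_ear:
  assumes st: "strong_on E H"
  shows "strong_on E (H \<union> set ps)"
proof -
  let ?R = "E \<inter> (H \<union> set ps) \<times> (H \<union> set ps)"
  have e: "x \<in> H" "y \<in> H" "successively (\<lambda>a b. (a, b) \<in> E) (x # ps @ [y])"
    using shortest_ear_ear unfolding ear_def by auto
  have walk: "(hd zs, last zs) \<in> ?R\<^sup>*"
    if "successively (\<lambda>a b. (a, b) \<in> E) zs" "set zs \<subseteq> H \<union> set ps" "zs \<noteq> []" for zs
    using that by (induction zs rule: induct_list012) (auto intro: converse_rtrancl_into_rtrancl)
  have H: "(u, v) \<in> ?R\<^sup>*" if "u \<in> H" "v \<in> H" for u v
    using st that rtrancl_mono[of "E \<inter> H \<times> H" ?R] unfolding strong_on_def by blast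
  have into: "(x, p) \<in> ?R\<^sup>*" and outof: "(p, y) \<in> ?R\<^sup>*" if "p \<in> set ps" for p
  proof -
    obtain as bs where ps: "ps = as @ p # bs" using \<open>p \<in> set ps\<close> by (meson split_list)
    show "(x, p) \<in> ?R\<^sup>*" using walk[of "x # as @ [p]"] e ps
      by (auto simp: successively_append_iff successively_Cons hd_append split: if_splits)
    show "(p, y) \<in> ?R\<^sup>*" using walk[of "p # bs @ [y]"] e ps
      by (auto simp: successively_append_iff successively_Cons)
  qed
  have to: "(u, x) \<in> ?R\<^sup>*" if "u \<in> H \<union> set ps" for u
    using that H outof e by (metis UnE rtrancl_trans)
  have from_x: "(x, v) \<in> ?R\<^sup>*" if "v \<in> H \<union> set ps" for v
    using that H into e by blast
  show ?thesis unfolding strong_on_def using to from_x by (blast intro: rtrancl_trans)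
qed

end

section \<open>Three colours suffice\<close>

definition three_colouring :: "'a rel \<Rightarrow> 'a set \<Rightarrow> ('a \<Rightarrow> nat) \<Rightarrow> bool" where
  "three_colouring E H c \<longleftrightarrow> c ` H \<subseteq> {..<3} \<and> (\<forall>u\<in>H. \<forall>v\<in>H. (u, v) \<in> E \<longrightarrow> c u \<noteq> c v)"

lemma alternating_colouring:
  assumes "distinct xs" "xs \<noteq> []" "\<alpha> \<noteq> \<delta>"
  shows "\<exists>g. g ` set xs \<subseteq> {\<alpha>, \<delta>} \<and> g (last xs) = \<delta> \<and> successively (\<lambda>a b. g a \<noteq> g b) xs"
  using assms
proof (induction xs rule: induct_list012)
  case (3 u v xs)
  then obtain g where g: "g ` set (v # xs) \<subseteq> {\<alpha>, \<delta>}" "g (last (v # xs)) = \<delta>"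
    "successively (\<lambda>a b. g a \<noteq> g b) (v # xs)" by auto
  let ?h = "g(u := if g v = \<delta> then \<alpha> else \<delta>)"
  have "successively (\<lambda>a b. ?h a \<noteq> ?h b) (v # xs) = successively (\<lambda>a b. g a \<noteq> g b) (v # xs)"
    using 3 by (intro successively_cong) auto
  then show ?case using g 3 by (intro exI[of _ ?h]) auto
next
  case (2 u)
  then show ?case by (intro exI[of _ "\<lambda>_. \<delta>"]) auto
qed simp

lemma in_order_cases:
  assumes "a \<in> set ps" "b \<in> set ps" "a \<noteq> b"
  obtains as bs cs where "ps = as @ a # bs @ b # cs" | as bs cs where "ps = as @ b # bs @ a # cs"
proof -
  obtain us vs where ps: "ps = us @ a # vs" using assms(1) by (meson split_list)
  then consider "b \<in> set us" | "b \<in> set vs" using assms by auto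
  then show ?thesis
  proof cases
    case 1
    then obtain as bs where "us = as @ b # bs" by (meson split_list)
    then show ?thesis using that(2) ps by simp
  next
    case 2
    then obtain bs cs where "vs = bs @ b # cs" by (meson split_list)
    then show ?thesis using that(1) ps by simp
  qed
qed

text \<open>
  Let \<open>\<alpha>\<close> be the colour of \<open>x\<close>. The first vertex of the ear gets \<open>\<beta>\<close> and
  the others alternate between \<open>\<alpha>\<close> and \<open>\<delta>\<close> so as to end with \<open>\<delta>\<close>. Then
  consecutive vertices differ, the first and the last differ from each other, and both differ from
  \<open>x\<close>; no other arcs exist.
\<close>
lemma three_colouring_add_long_ear:
  assumes nb: "\<not> has_C13 E" and irr: "irrefl E" and se: "shortest_ear E S H x ps y"
    and st: "strong_on E H" and len: "2 \<le> length ps" and c: "three_colouring E H c"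
  shows "\<exists>c'. three_colouring E (H \<union> set ps) c'"
proof -
  note e = shortest_ear_ear[OF se, unfolded ear_def]
  have enter: "(x, hd ps) \<in> E" and leave: "(last ps, y) \<in> E"
    using e by (auto simp: successively_append_iff successively_Cons)
  have xy: "x = y" using long_ear_closed[OF se nb st len] e enter leave by blast
  have only_x: "h = x" if "h \<in> H" "p \<in> set ps" "(h, p) \<in> E \<or> (p, h) \<in> E" for h p
    using that long_ear_closed[OF se nb st len] shortest_ear_enter[OF se] shortest_ear_leave[OF se]
      e enter leave xy by metis
  obtain p qs where ps: "ps = p # qs" "qs \<noteq> []" using len by (cases ps) fastforce+
  define \<alpha> where "\<alpha> = c x"
  have "\<alpha> < 3" using c e unfolding \<alpha>_def three_colouring_def by blast
  then obtain \<beta> \<delta> :: nat where col: "\<beta> < 3" "\<delta> < 3" "\<alpha> \<noteq> \<beta>" "\<alpha> \<noteq> \<delta>" "\<beta> \<noteq> \<delta>"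
    by (metis less_Suc_eq less_irrefl numeral_3_eq_3 zero_less_Suc)
  have dist: "distinct ps" using shortest_ear_distinct[OF se] .
  obtain g where g: "g ` set qs \<subseteq> {\<alpha>, \<delta>}" "g (last qs) = \<delta>" "successively (\<lambda>a b. g a \<noteq> g b) qs"
    using alternating_colouring[of qs \<alpha> \<delta>] dist ps col by auto
  define f where "f = g(p := \<beta>)"
  have f_qs: "f a = g a" if "a \<in> set qs" for a using that dist ps by (auto simp: f_def)
  have f: "f (hd ps) = \<beta>" "f (last ps) = \<delta>" "f ` set ps \<subseteq> {..<3}"
    using ps g f_qs col \<open>\<alpha> < 3\<close> by (auto simp: f_def)
  have "successively (\<lambda>a b. f a \<noteq> f b) qs = successively (\<lambda>a b. g a \<noteq> g b) qs"
    using f_qs by (intro successively_cong) auto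
  moreover have "f p \<noteq> f (hd qs)"
  proof -
    have "g (hd qs) \<in> {\<alpha>, \<delta>}" using g(1) ps(2) hd_in_set by blast
    then show ?thesis using f_qs[of "hd qs"] ps(2) col by (auto simp: f_def)
  qed
  ultimately have f_succ: "successively (\<lambda>a b. f a \<noteq> f b) ps"
    using g ps by (simp add: successively_Cons)
  have f_ear: "f a \<noteq> f b" if ab: "a \<in> set ps" "b \<in> set ps" "(a, b) \<in> E" for a b
  proof -
    have "a \<noteq> b" using irr ab by (auto simp: irrefl_def)
    with ab(1,2) show ?thesis
    proof (cases rule: in_order_cases)
      case (1 as bs cs)
      then have "bs = []" using shortest_ear_forward[OF se] ab by blast
      then show ?thesis using f_succ 1 by (simp add: successively_append_iff)
    next
      case (2 as bs cs)
      then have "as = [] \<and> cs = []" using long_ear_backward[OF se nb xy] ab by blast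
      then show ?thesis using f col 2 by simp
    qed
  qed
  define c' where "c' v = (if v \<in> set ps then f v else c v)" for v
  have "three_colouring E (H \<union> set ps) c'"
    unfolding three_colouring_def
  proof (intro conjI ballI impI)
    show "c' ` (H \<union> set ps) \<subseteq> {..<3}"
      using f c unfolding three_colouring_def c'_def by auto
    fix u v assume u: "u \<in> H \<union> set ps" and v: "v \<in> H \<union> set ps" and uv: "(u, v) \<in> E"
    show "c' u \<noteq> c' v"
    proof (cases "u \<in> set ps"; cases "v \<in> set ps")
      assume "u \<in> set ps" "v \<in> set ps"
      then show ?thesis using f_ear uv by (simp add: c'_def)
    next
      assume "u \<in> set ps" "v \<notin> set ps"
      moreover from this have "v = x" "u = last ps"
        using v uv only_x shortest_ear_leave[OF se] by blast+
      ultimately show ?thesis using f col by (simp add: c'_def \<alpha>_def)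
    next
      assume "u \<notin> set ps" "v \<in> set ps"
      moreover from this have "u = x" "v = hd ps"
        using u uv only_x shortest_ear_enter[OF se] by blast+
      ultimately show ?thesis using f col by (simp add: c'_def \<alpha>_def)
    next
      assume "u \<notin> set ps" "v \<notin> set ps"
      then show ?thesis using u v uv c by (simp add: c'_def three_colouring_def)
    qed
  qed
  then show ?thesis by blast
qed

lemma three_colouring_add_vertex:
  assumes nb: "\<not> has_C13 E" and irr: "irrefl E" and st: "strong_on E H" and z: "z \<notin> H"
    and xy: "x \<in> H" "y \<in> H" "(x, z) \<in> E" "(z, y) \<in> E"
    and c: "three_colouring E H c"
  shows "\<exists>c'. three_colouring E (insert z H) c'"
proof -
  obtain a b where ab: "{w \<in> H. (w, z) \<in> E \<or> (z, w) \<in> E} \<subseteq> {a, b}"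
    using new_vertex_neighbours[OF nb st z xy] by blast
  obtain k :: nat where k: "k < 3" "k \<noteq> c a" "k \<noteq> c b"
    by (metis less_Suc_eq less_irrefl numeral_3_eq_3 zero_less_Suc)
  have "c w \<noteq> k" if "w \<in> H" "(w, z) \<in> E \<or> (z, w) \<in> E" for w
    using that ab k by blast
  then have "three_colouring E (insert z H) (c(z := k))"
    using c k z irr unfolding three_colouring_def irrefl_def by auto
  then show ?thesis by blast
qed

lemma three_colouring_extend:
  assumes nb: "\<not> has_C13 E" and irr: "irrefl E" and fin: "finite S" and st: "strong_on E S"
    and "H \<subseteq> S" "H \<noteq> {}" "strong_on E H" "three_colouring E H c"
  shows "\<exists>c. three_colouring E S c"
  using assms(5-8)
proof (induction "card (S - H)" arbitrary: H c rule: less_induct)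
  case less
  show ?case
  proof (cases "H = S")
    case True
    then show ?thesis using less by blast
  next
    case False
    then obtain x ps y where se: "shortest_ear E S H x ps y"
      using shortest_ear_exists[OF st less.prems(1,2)] by blast
    note e = shortest_ear_ear[OF se, unfolded ear_def]
    have "\<exists>c'. three_colouring E (H \<union> set ps) c'"
    proof (cases "2 \<le> length ps")
      case True
      then show ?thesis using three_colouring_add_long_ear[OF nb irr se] less.prems by blast
    next
      case False
      then obtain z where z: "ps = [z]" using e by (cases ps) (auto simp: Suc_le_eq)
      then show ?thesis
        using three_colouring_add_vertex[OF nb irr less.prems(3) _ _ _ _ _ less.prems(4), of z x y] e
        by auto
    qed
    then obtain c' where c': "three_colouring E (H \<union> set ps) c'" by blast
    have "card (S - (H \<union> set ps)) < card (S - H)"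
    proof (rule psubset_card_mono)
      show "S - (H \<union> set ps) \<subset> S - H" using e hd_in_set[of ps] by blast
    qed (use fin in simp)
    then show ?thesis
      using less.hyps[OF _ _ _ strong_on_add_ear[OF se less.prems(3)] c'] e less.prems by blast
  qed
qed

lemma strong_on_three_colourable:
  assumes nb: "\<not> has_C13 E" and irr: "irrefl E" and fin: "finite S" and st: "strong_on E S"
  shows "\<exists>c. three_colouring E S c"
proof (cases "S = {}")
  case True
  then show ?thesis by (simp add: three_colouring_def)
next
  case False
  then obtain s where "s \<in> S" by blast
  moreover have "three_colouring E {s} (\<lambda>_. 0)" "strong_on E {s}"
    using irr by (auto simp: three_colouring_def irrefl_def strong_on_def)
  ultimately show ?thesis using three_colouring_extend[OF nb irr fin st, of "{s}"] by blast
qed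

section \<open>Subdivisions of C(1,3)\<close>

lemma parcs_two_block_cycle_1_3:
  "parcs (two_block_cycle 1 3) = {(0, 1), (2, 1), (3, 2), (0, 3)}"
proof -
  have "{(Suc i mod 4, i) | i. 1 \<le> i \<and> i < 4} = {(2, 1), (3, 2), (0, 3)}"
    (is "?L = ?R")
  proof
    have "i = 1 \<or> i = 2 \<or> i = 3" if "1 \<le> i" "i < 4" for i :: nat using that by auto
    then show "?L \<subseteq> ?R" by fastforce
    show "?R \<subseteq> ?L" by force
  qed
  then show ?thesis by (auto simp: two_block_cycle_def)
qed

lemma pverts_two_block_cycle_1_3: "pverts (two_block_cycle 1 3) = {0, 1, 2, 3}"
  by (auto simp: two_block_cycle_def)

text \<open>
  Zipping a vertex list with its tail turns it into the corresponding arc list.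
\<close>
lemma apath_of_dipath:
  assumes "dipath E (u # ws @ [v])" "u \<in> pverts H" "set (zip (u # ws @ [v]) (ws @ [v])) \<subseteq> parcs H"
  shows "pre_digraph.apath (with_proj H) u (zip (u # ws @ [v]) (ws @ [v])) v"
proof -
  have "pcas u (zip (u # ws @ [v]) (ws @ [v])) v" for u ws by (induction ws arbitrary: u) auto
  moreover have "pawalk_verts u (zip (u # ws @ [v]) (ws @ [v])) = u # ws @ [v]" for u ws
    by (induction ws arbitrary: u) auto
  ultimately show ?thesis
    using assms unfolding pre_digraph.apath_def pre_digraph.awalk_def dipath_def
      cas_with_proj_eq awalk_verts_with_proj_eq by auto
qed

lemma inner_verts_of_dipath:
  "pre_digraph.inner_verts (with_proj H) (zip (u # ws @ [v]) (ws @ [v])) = ws"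
proof -
  have "map fst (zip (u # ws @ [v]) (ws @ [v])) = u # ws" for u
    by (induction ws arbitrary: u) auto
  then show ?thesis unfolding inner_verts_with_proj_def by simp
qed

lemma dipath_arcs:
  "successively (\<lambda>a b. (a, b) \<in> E) xs \<Longrightarrow> set (zip xs (tl xs)) \<subseteq> E"
  by (induction xs rule: induct_list012) auto

lemma dipath_Field:
  assumes "dipath E (u # ws @ [v])"
  shows "set (u # ws @ [v]) \<subseteq> Field E"
proof -
  have "set (u # ws @ [v]) \<subseteq> Field E" if "successively (\<lambda>a b. (a, b) \<in> E) (u # ws @ [v])"
    using that by (induction ws arbitrary: u) (auto simp: Field_def)
  then show ?thesis using assms unfolding dipath_def by blast
qed

text \<open>
  In \<open>two_block_cycle 1 3\<close> the vertex 0 is initial and 1 is terminal; the blocks are the arc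
  \<open>(0, 1)\<close> and the path \<open>0, 3, 2, 1\<close>. The first two inner vertices \<open>r\<close>, \<open>s\<close> of the
  long path play the roles of 3 and 2, so only the arcs \<open>(0, 1)\<close> and \<open>(2, 1)\<close> are properly
  subdivided.
\<close>
lemma has_C13_subdivision:
  assumes D: "pair_digraph D" and "has_C13 (parcs D)"
  shows "\<exists>H. is_subdivision (two_block_cycle 1 3) H \<and> subgraph (with_proj H) (with_proj D)"
proof -
  interpret pair_digraph D by fact
  obtain u v ps qs where p: "dipath (parcs D) (u # ps @ [v])" and q: "dipath (parcs D) (u # qs @ [v])"
    and disj: "set ps \<inter> set qs = {}" and len: "2 \<le> length qs"
    using assms(2)[unfolded has_C13_def] by (elim exE conjE) (rule that)
  then obtain r s ts where qs: "qs = r # s # ts" by (metis One_nat_def Suc_1 Suc_le_length_iff)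
  define \<phi> :: "nat \<Rightarrow> 'a" where "\<phi> n = (if n = 0 then u else if n = 1 then v else if n = 2 then s else r)" for n
  define W :: "nat \<times> nat \<Rightarrow> 'a list" where "W e = (if e = (0, 1) then ps else if e = (2, 1) then ts else [])" for e
  define P where "P e = zip (\<phi> (fst e) # W e @ [\<phi> (snd e)]) (W e @ [\<phi> (snd e)])" for e
  let ?F = "two_block_cycle 1 3"
  define H where "H = \<lparr> pverts = \<phi> ` pverts ?F \<union> (\<Union>e \<in> parcs ?F. set (W e)),
    parcs = (\<Union>e \<in> parcs ?F. set (P e)) \<rparr>"
  have paths: "dipath (parcs D) (\<phi> (fst e) # W e @ [\<phi> (snd e)])" if "e \<in> parcs ?F" for e
    using that p q unfolding parcs_two_block_cycle_1_3 qs
    by (auto simp: \<phi>_def W_def dipath_def successively_append_iff successively_Cons)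
  have PH: "set (P e) \<subseteq> parcs H" if "e \<in> parcs ?F" for e
    using that by (auto simp: H_def)
  have PD: "set (P e) \<subseteq> parcs D" if "e \<in> parcs ?F" for e
    using dipath_arcs[of "parcs D"] paths[OF that] unfolding P_def dipath_def by fastforce
  have H_verts: "pverts H = (\<Union>e \<in> parcs ?F. set (\<phi> (fst e) # W e @ [\<phi> (snd e)]))"
    unfolding H_def parcs_two_block_cycle_1_3 pverts_two_block_cycle_1_3 by auto
  have \<phi>H: "\<phi> (fst e) \<in> pverts H" if "e \<in> parcs ?F" for e
    using that unfolding H_verts by auto
  have inner: "pre_digraph.inner_verts (with_proj H) (P e) = W e" for e
    unfolding P_def by (rule inner_verts_of_dipath)
  have "is_subdivision ?F H"
    unfolding is_subdivision_def
  proof (intro exI[of _ \<phi>] exI[of _ P] conjI ballI impI)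
    show "inj_on \<phi> (pverts ?F)"
      using q unfolding pverts_two_block_cycle_1_3 qs by (auto simp: inj_on_def \<phi>_def dipath_def)
    show "pre_digraph.apath (with_proj H) (\<phi> (fst e)) (P e) (\<phi> (snd e))" if "e \<in> parcs ?F" for e
      using apath_of_dipath[OF paths[OF that] \<phi>H[OF that]] PH[OF that] unfolding P_def by blast
    show "1 \<le> length (P e)" for e by (simp add: P_def)
    show "set (pre_digraph.inner_verts (with_proj H) (P e)) \<inter> \<phi> ` pverts ?F = {}"
      if "e \<in> parcs ?F" for e
      using that p q disj unfolding inner pverts_two_block_cycle_1_3 parcs_two_block_cycle_1_3 qs
      by (auto simp: \<phi>_def W_def dipath_def)
    show "set (pre_digraph.inner_verts (with_proj H) (P e)) \<inter>
        set (pre_digraph.inner_verts (with_proj H) (P e')) = {}"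
      if "e \<in> parcs ?F" "e' \<in> parcs ?F" "e \<noteq> e'" for e e'
      using that disj unfolding inner parcs_two_block_cycle_1_3 qs by (auto simp: W_def)
    show "pverts H = \<phi> ` pverts ?F \<union>
        (\<Union>e \<in> parcs ?F. set (pre_digraph.inner_verts (with_proj H) (P e)))"
      unfolding inner by (simp add: H_def)
    show "parcs H = (\<Union>e \<in> parcs ?F. set (P e))" by (simp add: H_def)
  qed
  moreover have "subgraph (with_proj H) (with_proj D)"
  proof -
    have "set (\<phi> (fst e) # W e @ [\<phi> (snd e)]) \<subseteq> pverts D" if "e \<in> parcs ?F" for e
      using dipath_Field[OF paths[OF that]] wellformed' by (auto simp: Field_def)
    then have "pverts H \<subseteq> pverts D" unfolding H_verts by blast
    moreover have "parcs H \<subseteq> parcs D" using PD by (auto simp: H_def)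
    moreover have "fst a \<in> pverts H \<and> snd a \<in> pverts H" if a: "a \<in> parcs H" for a
    proof -
      obtain e where e: "e \<in> parcs ?F" "a \<in> set (P e)" using a unfolding H_def by auto
      then have "fst a \<in> set (\<phi> (fst e) # W e @ [\<phi> (snd e)])" "snd a \<in> set (W e @ [\<phi> (snd e)])"
        unfolding P_def by (metis prod.collapse set_zip_leftD, metis prod.collapse set_zip_rightD)
      moreover have "set (\<phi> (fst e) # W e @ [\<phi> (snd e)]) \<subseteq> pverts H"
        using e(1) unfolding H_verts by blast
      ultimately show ?thesis by auto
    qed
    ultimately show ?thesis unfolding subgraph_def compatible_def
      using wf_digraph_axioms by (auto intro!: wf_digraph.intro)
  qed
  ultimately show ?thesis by blast
qed

section \<open>The chromatic number of the class\<close>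

lemma chromatic_number_le_3:
  assumes "D \<in> S_Forb (two_block_cycle 1 3) \<inter> strong_digraphs"
  shows "chromatic_number D \<le> 3"
proof -
  have D: "pair_digraph D" "strongly_connected (with_proj D)"
    using assms unfolding strong_digraphs_def by auto
  interpret pair_digraph D by fact
  have nb: "\<not> has_C13 (parcs D)"
    using has_C13_subdivision[OF D(1)] assms unfolding S_Forb_def by auto
  have irr: "irrefl (parcs D)" using pair_no_loops by (force simp: irrefl_def)
  have "strong_on (parcs D) (pverts D)"
    unfolding strong_on_def
  proof (intro ballI)
    fix u v assume "u \<in> pverts D" "v \<in> pverts D"
    then have "(u, v) \<in> rtrancl_on (pverts D) (parcs D)"
      using D(2) unfolding strongly_connected_def reachable_def by auto
    moreover have "parcs D \<inter> pverts D \<times> pverts D = parcs D"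
      using wellformed' by auto
    ultimately show "(u, v) \<in> (parcs D \<inter> pverts D \<times> pverts D)\<^sup>*"
      by (metis rtrancl_on_rtranclI)
  qed
  then obtain c where "three_colouring (parcs D) (pverts D) c"
    using strong_on_three_colourable[OF nb irr pair_finite_verts] by blast
  then have "proper_colouring (mk_symmetric (with_proj D)) 3 c"
    using wellformed' unfolding proper_colouring_def three_colouring_def mk_symmetric_def
    by fastforce
  then show ?thesis unfolding chromatic_number_def by (intro Least_le) blast
qed

lemma directed_triangle:
  assumes "distinct [a, b, c :: 'a]"
  defines "T \<equiv> \<lparr> pverts = {a, b, c}, parcs = {(a, b), (b, c), (c, a)} \<rparr>"
  shows "T \<in> S_Forb (two_block_cycle 1 3) \<inter> strong_digraphs" "3 \<le> chromatic_number T"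
proof -
  have T: "pair_digraph T"
    using assms(1) unfolding T_def by unfold_locales auto
  let ?R = "rtrancl_on (pverts T) (parcs T)"
  have "(a, b) \<in> ?R" "(b, c) \<in> ?R" "(c, a) \<in> ?R"
    by (rule rtrancl_on_into_rtrancl_on[OF rtrancl_on_refl]; simp add: T_def)+
  moreover from this have "(a, c) \<in> ?R" "(b, a) \<in> ?R" "(c, b) \<in> ?R"
    by (metis rtrancl_on_trans)+
  ultimately have "(u, v) \<in> ?R" if "u \<in> pverts T" "v \<in> pverts T" for u v
    using that by (cases "u = v") (auto simp: T_def)
  then have "T \<in> strong_digraphs"
    using T unfolding strong_digraphs_def strongly_connected_def reachable_def
    by (auto simp: T_def)
  moreover have False if sub: "is_subdivision (two_block_cycle 1 3) H" "subgraph (with_proj H) (with_proj T)" for H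
  proof -
    obtain \<phi> :: "nat \<Rightarrow> 'a" where \<phi>: "inj_on \<phi> {0, 1, 2, 3}" "\<phi> ` {0, 1, 2, 3} \<subseteq> pverts H"
      using sub(1) unfolding is_subdivision_def pverts_two_block_cycle_1_3
      by (elim exE conjE) (rule that, assumption, metis Un_upper1)
    have "pverts H \<subseteq> {a, b, c}" using sub(2) by (auto simp: subgraph_def T_def)
    then have "card (\<phi> ` {0, 1, 2, 3}) \<le> card {a, b, c}" using \<phi>(2) by (intro card_mono) auto
    moreover have "card (\<phi> ` {0, 1, 2, 3}) = 4" by (subst card_image[OF \<phi>(1)]) simp
    moreover have "card {a, b, c} = 3" using assms(1) by simp
    ultimately show False by linarith
  qed
  ultimately show "T \<in> S_Forb (two_block_cycle 1 3) \<inter> strong_digraphs"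
    using T unfolding S_Forb_def by blast
  have colours: "proper_colouring (mk_symmetric (with_proj T)) k f \<longleftrightarrow>
      f a < k \<and> f b < k \<and> f c < k \<and> f a \<noteq> f b \<and> f b \<noteq> f c \<and> f c \<noteq> f a" for k f
    unfolding proper_colouring_def mk_symmetric_def T_def by auto
  have "\<exists>f. proper_colouring (mk_symmetric (with_proj T)) 3 f"
    unfolding colours using assms(1)
    by (intro exI[of _ "\<lambda>v. if v = a then 0 else if v = b then 1 else 2"]) auto
  then have "\<exists>f. proper_colouring (mk_symmetric (with_proj T)) (chromatic_number T) f"
    unfolding chromatic_number_def by (rule LeastI)
  then show "3 \<le> chromatic_number T" unfolding colours by auto
qed

theorem corollary40:
  shows "class_chromatic_number
    (S_Forb (two_block_cycle 1 3) \<inter> (strong_digraphs :: 'a::infinite pair_pre_digraph set)) = 3"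
proof -
  let ?C = "S_Forb (two_block_cycle 1 3) \<inter> (strong_digraphs :: 'a pair_pre_digraph set)"
  obtain A :: "'a set" where "finite A" "card A = 3"
    using infinite_arbitrarily_large[OF infinite_UNIV] by blast
  then obtain a b c :: 'a where "distinct [a, b, c]"
    by (auto simp: card_3_iff)
  from directed_triangle[OF this] obtain T where T: "T \<in> ?C" "3 \<le> chromatic_number T" by blast
  have "(LEAST m. \<forall>D \<in> ?C. chromatic_number D \<le> m) = 3"
    using chromatic_number_le_3 T by (intro Least_equality) (blast intro: order_trans)+
  moreover have "\<exists>m. \<forall>D \<in> ?C. chromatic_number D \<le> m"
    using chromatic_number_le_3 by blast
  ultimately show ?thesis unfolding class_chromatic_number_def by (simp add: numeral_eq_enat)
qed

end
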